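(* Let $R$ be a finite noncommutative ring such that $|R|\notin\{8,12\}$, and let $r\in K(R)$. Then $\Delta_R^r$ has a vertex of degree $2$ if and only if $r=0$ and $R$ is isomorphic to $E(4)$ or $F(4)$.
   Context: Rings are associative and not assumed to have a unity. $[x,y]:=xy-yx$ and $K(R):=\{[x,y]:x,y\in R\}$. $Z(R)$ is the center of $R$. $\Delta_R^r$ is the simple undirected graph with vertex set $R\setminus Z(R)$ in which two distinct vertices $x,y$ are adjacent if and only if $[x,y]\neq r$ and $[x,y]\neq -r$. For a prime $p$, $E(p^2)=\langle a,b: pa=pb=0,\ a^2=a,\ b^2=b,\ ab=a,\ ba=b\rangle$ and $F(p^2)=\langle x,y: px=py=0,\ x^2=x,\ y^2=y,\ xy=y,\ yx=x\rangle$; these are (non-unital) rings of order $p^2$ whose additive group is free over $\mathbb{Z}/p$ on the two generators, with multiplication determined bilinearly by the given relations. *)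

theory Defs
  imports "HOL-Library.Numeral_Type" "Graph_Theory.Graph_Theory"
begin

text \<open>
  Rings without assumed unity are the instances of the type class \<^class>\<open>ring\<close>.
\<close>

definition commutator :: "'a::ring \<Rightarrow> 'a \<Rightarrow> 'a"
  where "commutator x y = x * y - y * x"

definition commutators :: "'a::ring set"
  where "commutators = {commutator x y | x y. True}"

definition ring_center :: "'a::ring set"
  where "ring_center = {z. \<forall>x. z * x = x * z}"

definition ring_isomorphism :: "('a::ring \<Rightarrow> 'b::ring) \<Rightarrow> bool"
  where "ring_isomorphism f \<longleftrightarrow>
    bij f \<and> (\<forall>x y. f (x + y) = f x + f y) \<and> (\<forall>x y. f (x * y) = f x * f y)"

text \<open>
  A simple undirected graph is represented, as usual in \<^theory>\<open>Graph_Theory.Digraph\<close>, by a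
  loop-free symmetric digraph without parallel arcs (lemma \<open>pair_graph_r_nc_graph\<close> below): each
  edge contributes one arc in each direction. The degree of a vertex (its number of neighbours) is
  therefore its out-degree.
\<close>

definition r_nc_graph :: "'a::ring \<Rightarrow> 'a pair_pre_digraph"
  where "r_nc_graph r =
    \<lparr> pverts = - ring_center,
      parcs = {(x, y). x \<notin> ring_center \<and> y \<notin> ring_center \<and> x \<noteq> y \<and>
                       commutator x y \<noteq> r \<and> commutator x y \<noteq> - r} \<rparr>"

abbreviation graph_degree :: "'a pair_pre_digraph \<Rightarrow> 'a \<Rightarrow> nat"
  where "graph_degree G v \<equiv> out_degree (with_proj G) v"

lemma commutator_swap: "commutator y x = - commutator x y"
  by (simp add: commutator_def)

lemma pair_graph_r_nc_graph: "pair_graph (r_nc_graph (r :: 'a::{ring, finite}))"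
proof
  have "- commutator x y = r \<longleftrightarrow> commutator x y = - r"
    and "- commutator x y = - r \<longleftrightarrow> commutator x y = r" for x y :: 'a
    by auto
  then have "sym (parcs (r_nc_graph r))"
    unfolding sym_def r_nc_graph_def
    by simp (metis commutator_swap)
  then show "symmetric (with_proj (r_nc_graph r))"
    by (simp add: symmetric_def arcs_ends_def arc_to_ends_def)
qed (auto simp: r_nc_graph_def)

lemma graph_degree_r_nc_graph:
  "graph_degree (r_nc_graph r) x =
    card {y. (x, y) \<in> parcs (r_nc_graph r)}"
proof -
  have "out_arcs (with_proj (r_nc_graph r)) x = Pair x ` {y. (x, y) \<in> parcs (r_nc_graph r)}"
    by (auto simp: out_arcs_def)
  then show ?thesis
    by (simp add: out_degree_def card_image inj_on_def)
qed

text \<open>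
  The rings \<open>E(p\<^sup>2)\<close> and \<open>F(p\<^sup>2)\<close>, over an arbitrary commutative coefficient ring \<open>'k\<close>: the
  free \<open>'k\<close>-modules on two generators, with the multiplication obtained by bilinear
  extension of the relations
  \<open>a\<^sup>2 = a\<close>, \<open>b\<^sup>2 = b\<close>, \<open>ab = a\<close>, \<open>ba = b\<close>, respectively
  \<open>x\<^sup>2 = x\<close>, \<open>y\<^sup>2 = y\<close>, \<open>xy = y\<close>, \<open>yx = x\<close>.
  The element \<open>E_elem \<alpha> \<beta>\<close> stands for \<open>\<alpha>a + \<beta>b\<close>, and
  \<open>F_elem \<alpha> \<beta>\<close> for \<open>\<alpha>x + \<beta>y\<close>.
  For a numeral type \<open>p > 1\<close>, the type \<open>p\<close> itself is the ring of integers modulo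
  \<open>p\<close>, so that \<open>E(p\<^sup>2)\<close> is the type \<open>p E_ring\<close>; in particular
  \<open>E(4)\<close> is \<open>2 E_ring\<close> and \<open>F(4)\<close> is \<open>2 F_ring\<close>.
\<close>

datatype 'k E_ring = E_elem 'k 'k

instantiation E_ring :: (comm_ring) ring
begin

definition zero_E_ring :: "'a E_ring"
  where "0 = E_elem 0 0"

fun plus_E_ring :: "'a E_ring \<Rightarrow> 'a E_ring \<Rightarrow> 'a E_ring"
  where "E_elem s t + E_elem u v = E_elem (s + u) (t + v)"

fun uminus_E_ring :: "'a E_ring \<Rightarrow> 'a E_ring"
  where "- E_elem s t = E_elem (- s) (- t)"

fun minus_E_ring :: "'a E_ring \<Rightarrow> 'a E_ring \<Rightarrow> 'a E_ring"
  where "E_elem s t - E_elem u v = E_elem (s - u) (t - v)"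

fun times_E_ring :: "'a E_ring \<Rightarrow> 'a E_ring \<Rightarrow> 'a E_ring"
  where "E_elem s t * E_elem u v = E_elem (s * u + s * v) (t * u + t * v)"

instance
proof
  fix x y z :: "'a E_ring"
  show "x + y + z = x + (y + z)" "x * y * z = x * (y * z)"
    "(x + y) * z = x * z + y * z" "x * (y + z) = x * y + x * z"
    by (cases x; cases y; cases z; simp add: algebra_simps)+
  show "x + y = y + x" "x - y = x + - y"
    by (cases x; cases y; simp add: algebra_simps)+
  show "0 + x = x" "- x + x = 0"
    by (cases x; simp add: zero_E_ring_def)+
qed

end

datatype 'k F_ring = F_elem 'k 'k

instantiation F_ring :: (comm_ring) ring
begin

definition zero_F_ring :: "'a F_ring"
  where "0 = F_elem 0 0"

fun plus_F_ring :: "'a F_ring \<Rightarrow> 'a F_ring \<Rightarrow> 'a F_ring"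
  where "F_elem s t + F_elem u v = F_elem (s + u) (t + v)"

fun uminus_F_ring :: "'a F_ring \<Rightarrow> 'a F_ring"
  where "- F_elem s t = F_elem (- s) (- t)"

fun minus_F_ring :: "'a F_ring \<Rightarrow> 'a F_ring \<Rightarrow> 'a F_ring"
  where "F_elem s t - F_elem u v = F_elem (s - u) (t - v)"

fun times_F_ring :: "'a F_ring \<Rightarrow> 'a F_ring \<Rightarrow> 'a F_ring"
  where "F_elem s t * F_elem u v = F_elem (s * u + t * u) (s * v + t * v)"

instance
proof
  fix x y z :: "'a F_ring"
  show "x + y + z = x + (y + z)" "x * y * z = x * (y * z)"
    "(x + y) * z = x * z + y * z" "x * (y + z) = x * y + x * z"
    by (cases x; cases y; cases z; simp add: algebra_simps)+
  show "x + y = y + x" "x - y = x + - y"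
    by (cases x; cases y; simp add: algebra_simps)+
  show "0 + x = x" "- x + x = 0"
    by (cases x; simp add: zero_F_ring_def)+
qed

end

lemma E_ring_relations:
  fixes a b :: "'k::comm_ring_1 E_ring"
  defines "a \<equiv> E_elem 1 0" and "b \<equiv> E_elem 0 1"
  shows "a * a = a" "b * b = b" "a * b = a" "b * a = b"
  by (simp_all add: a_def b_def)

lemma F_ring_relations:
  fixes x y :: "'k::comm_ring_1 F_ring"
  defines "x \<equiv> F_elem 1 0" and "y \<equiv> F_elem 0 1"
  shows "x * x = x" "y * y = y" "x * y = y" "y * x = x"
  by (simp_all add: x_def y_def)

lemma card_E_ring: "CARD('k E_ring) = CARD('k) ^ 2"
proof -
  have "bij (\<lambda>(s, t). E_elem s t :: 'k E_ring)"
    by (rule bijI) (auto simp: inj_on_def image_iff, metis E_ring.exhaust)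
  from bij_betw_same_card[OF this] show ?thesis
    by (simp add: power2_eq_square)
qed

lemma card_F_ring: "CARD('k F_ring) = CARD('k) ^ 2"
proof -
  have "bij (\<lambda>(s, t). F_elem s t :: 'k F_ring)"
    by (rule bijI) (auto simp: inj_on_def image_iff, metis F_ring.exhaust)
  from bij_betw_same_card[OF this] show ?thesis
    by (simp add: power2_eq_square)
qed

end

(* For a noncentral vertex x, the solutions y of [x, y] = r form a coset of the centralizer C(x)
   if there are any. So the degree of x is |R| - |C(x)| for r = 0, and
   |R| - |Z(R)| - 1 - j |C(x)| with j in {0, 1, 2} otherwise. If the degree is 2, Lagrange's
   theorem for Z(R) < C(x) < R gives |R| = 4 in the first case and |R| in {4, 6, 8, 12, 18} with
   |Z(R)| odd in the second. The orders 6 and 18 are impossible: if |R| is twice an odd number,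
   then R has an element z of additive order 2; it is central, since otherwise both C(z) and [z, R]
   have even order, although |R| = |C(z)| |[z, R]|; so |Z(R)| is even.
   If |R| = 4, every noncentral x satisfies [x, y] = r for some y, so j = 0 does not occur. *)

theory Submission imports Defs begin

section \<open>Additive subgroups: Lagrange's theorem and elements of order 2\<close>

definition additive_subgroup :: "'a::ab_group_add set \<Rightarrow> bool"
  where "additive_subgroup H \<longleftrightarrow> 0 \<in> H \<and> (\<forall>x\<in>H. \<forall>y\<in>H. x - y \<in> H)"

lemma additive_subgroup_zero: "additive_subgroup H \<Longrightarrow> 0 \<in> H"
  and additive_subgroup_diff: "additive_subgroup H \<Longrightarrow> x \<in> H \<Longrightarrow> y \<in> H \<Longrightarrow> x - y \<in> H"
  by (auto simp: additive_subgroup_def)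

lemma additive_subgroup_uminus: "additive_subgroup H \<Longrightarrow> x \<in> H \<Longrightarrow> - x \<in> H"
  using additive_subgroup_diff[of H 0 x] additive_subgroup_zero[of H] by simp

lemma additive_subgroup_add: "additive_subgroup H \<Longrightarrow> x \<in> H \<Longrightarrow> y \<in> H \<Longrightarrow> x + y \<in> H"
  using additive_subgroup_diff[of H x "- y"] additive_subgroup_uminus[of H y] by simp

text \<open>Lagrange's theorem: the cosets of \<open>H\<close> by elements of \<open>K\<close> are
  pairwise disjoint, have \<open>card H\<close> elements each, and cover \<open>K\<close>.\<close>

lemma additive_subgroup_card_dvd:
  fixes H K :: "'a::{ab_group_add, finite} set"
  assumes H: "additive_subgroup H" and K: "additive_subgroup K" and "H \<subseteq> K"
  shows "card H dvd card K"
proof -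
  let ?cosets = "(\<lambda>k. (+) k ` H) ` K"
  have "K \<subseteq> \<Union> ?cosets"
    using additive_subgroup_zero[OF H] by force
  moreover have "\<Union> ?cosets \<subseteq> K"
    using additive_subgroup_add[OF K] \<open>H \<subseteq> K\<close> by auto
  ultimately have union: "\<Union> ?cosets = K"
    by auto
  \<comment> \<open>Cosets with a common element satisfy one inclusion; exchanging \<open>k\<close>
    and \<open>l\<close> gives the other, so they are equal.\<close>
  have sub: "(+) k ` H \<subseteq> (+) l ` H" if "k + h = l + h'" "h \<in> H" "h' \<in> H" for k l h h'
  proof
    fix z assume "z \<in> (+) k ` H"
    then obtain g where g: "g \<in> H" "z = k + g" by auto
    have "k = l + (h' - h)"
      using that(1) by (metis add_diff_cancel_right' add_diff_eq)
    then have "z = l + ((h' - h) + g)"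
      using g by (simp add: add.assoc)
    moreover have "(h' - h) + g \<in> H"
      using that g H by (intro additive_subgroup_add additive_subgroup_diff)
    ultimately show "z \<in> (+) l ` H" by blast
  qed
  have "(+) k ` H = (+) l ` H" if "(+) k ` H \<inter> (+) l ` H \<noteq> {}" for k l
  proof -
    obtain h h' where "k + h = l + h'" "h \<in> H" "h' \<in> H"
      using \<open>(+) k ` H \<inter> (+) l ` H \<noteq> {}\<close> by blast
    then show ?thesis
      using sub[of k h l h'] sub[of l h' k h] by auto
  qed
  then have "card H dvd card (\<Union> ?cosets)"
    by (intro dvd_partition) (auto simp: card_image)
  then show ?thesis
    by (simp add: union)
qed

text \<open>The set \<open>{0, z}\<close> is a subgroup of order 2, so Lagrange's theorem
  applies.\<close>

lemma even_card_subgroupI: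
  fixes H :: "'a::{ab_group_add, finite} set"
  assumes "additive_subgroup H" "z \<in> H" "z \<noteq> 0" "z + z = 0"
  shows "even (card H)"
proof -
  have "- z = z"
    using assms(4) by (simp add: minus_unique)
  then have "additive_subgroup {0, z}"
    using assms(4) by (auto simp: additive_subgroup_def)
  moreover have "{0, z} \<subseteq> H"
    using assms additive_subgroup_zero by auto
  ultimately have "card {0, z} dvd card H"
    using assms(1) by (intro additive_subgroup_card_dvd)
  then show ?thesis
    using \<open>z \<noteq> 0\<close> by (simp add: numeral_2_eq_2)
qed

text \<open>If no nonzero element were its own negative, the pairs \<open>{z, - z}\<close> would
  partition the nonzero elements into sets of size 2, and the order would be odd.\<close>

lemma exists_additive_involution:
  assumes "even CARD('a::{ab_group_add, finite})"
  obtains z :: "'a::{ab_group_add, finite}" where "z \<noteq> 0" "z + z = 0"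
proof (rule ccontr)
  assume "\<not> thesis"
  then have no: "z = 0" if "z + z = 0" for z :: 'a
    using that \<open>\<And>z. z \<noteq> 0 \<Longrightarrow> z + z = 0 \<Longrightarrow> thesis\<close> by blast
  let ?pairs = "(\<lambda>z::'a. {z, - z}) ` (- {0})"
  have "z \<noteq> - z" if "z \<noteq> 0" for z :: 'a
    using no[of z] that by (metis add.right_inverse)
  then have "2 dvd card (\<Union> ?pairs)"
    by (intro dvd_partition) auto
  moreover have "\<Union> ?pairs = - {0}"
    by auto
  ultimately show False
    using assms by (simp add: Compl_eq_Diff_UNIV card_Diff_subset)
qed

section \<open>Commutators, centralizers and the center\<close>

lemma commutator_add_right: "commutator x (y + z) = commutator x y + commutator x z"
  and commutator_diff_right: "commutator x (y - z) = commutator x y - commutator x z"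
  and commutator_minus_right: "commutator x (- y) = - commutator x y"
  and commutator_add_left: "commutator (x + y) z = commutator x z + commutator y z"
  and commutator_self: "commutator x x = 0"
  and commutator_zero_right: "commutator x 0 = 0"
  and commutator_zero_left: "commutator 0 x = 0"
  by (simp_all add: commutator_def algebra_simps)

lemmas commutator_simps = commutator_add_right commutator_minus_right commutator_add_left
  commutator_self commutator_zero_right commutator_zero_left

definition centralizer :: "'a::ring \<Rightarrow> 'a set"
  where "centralizer x = {y. commutator x y = 0}"

lemma additive_subgroup_centralizer: "additive_subgroup (centralizer x)"
  and additive_subgroup_range_commutator: "additive_subgroup (range (commutator x))"
  and additive_subgroup_ring_center: "additive_subgroup (ring_center :: 'a::ring set)"
proof -
  show "additive_subgroup (centralizer x)"
    by (auto simp: additive_subgroup_def centralizer_def commutator_diff_right commutator_simps)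
  show "additive_subgroup (ring_center :: 'a::ring set)"
    by (auto simp: additive_subgroup_def ring_center_def algebra_simps)
  show "additive_subgroup (range (commutator x))"
    unfolding additive_subgroup_def
  proof (intro conjI ballI)
    show "0 \<in> range (commutator x)"
      by (metis commutator_self rangeI)
    fix u v assume "u \<in> range (commutator x)" "v \<in> range (commutator x)"
    then obtain y z where "u - v = commutator x (y - z)"
      by (auto simp: commutator_diff_right)
    then show "u - v \<in> range (commutator x)"
      by simp
  qed
qed

lemma ring_center_subset_centralizer: "ring_center \<subseteq> centralizer x"
  by (auto simp: ring_center_def centralizer_def commutator_def)

lemma self_in_centralizer: "x \<in> centralizer x"
  by (simp add: centralizer_def commutator_self)

lemma not_central_iff: "x \<notin> ring_center \<longleftrightarrow> (\<exists>y. commutator x y \<noteq> 0)"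
  by (auto simp: ring_center_def commutator_def)

text \<open>The map \<open>commutator x\<close> is additive with kernel
  \<open>centralizer x\<close>, so each nonempty fibre is a coset of that kernel.\<close>

lemma card_commutator_fibre:
  fixes x :: "'a::{ring, finite}"
  assumes "r \<in> range (commutator x)"
  shows "card {y. commutator x y = r} = card (centralizer x)"
proof -
  obtain y where y: "commutator x y = r"
    using assms by auto
  have "{z. commutator x z = r} = (+) y ` centralizer x"
  proof (intro equalityI subsetI)
    fix z assume "z \<in> {z. commutator x z = r}"
    then have "z - y \<in> centralizer x"
      using y by (simp add: centralizer_def commutator_diff_right)
    then have "y + (z - y) \<in> (+) y ` centralizer x"
      by (rule imageI)
    then show "z \<in> (+) y ` centralizer x"
      by simp
  qed (use y in \<open>auto simp: centralizer_def commutator_add_right\<close>)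
  then show ?thesis
    by (simp add: card_image)
qed

lemma card_range_commutator:
  fixes x :: "'a::{ring, finite}"
  shows "CARD('a) = card (range (commutator x)) * card (centralizer x)"
proof -
  have "CARD('a) = (\<Sum>r\<in>range (commutator x). card {y. commutator x y = r})"
    \<comment> \<open>Count the ring fibre by fibre.\<close>
    using sum.image_gen[of "UNIV :: 'a set" "\<lambda>_. 1 :: nat" "commutator x"] by simp
  then show ?thesis
    by (simp add: card_commutator_fibre)
qed

lemma card_subgroups:
  fixes x :: "'a::{ring, finite}"
  assumes "x \<notin> ring_center"
  shows "card (ring_center :: 'a set) dvd card (centralizer x)"
    and "card (centralizer x) dvd CARD('a)"
    and "card (ring_center :: 'a set) < card (centralizer x)"
    and "card (centralizer x) < CARD('a)"
    and "0 < card (ring_center :: 'a set)"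
proof -
  show "card (ring_center :: 'a set) dvd card (centralizer x)"
    by (intro additive_subgroup_card_dvd additive_subgroup_centralizer
        additive_subgroup_ring_center ring_center_subset_centralizer)
  show "card (centralizer x) dvd CARD('a)"
    by (simp add: card_range_commutator[of x])
  show "card (ring_center :: 'a set) < card (centralizer x)"
    \<comment> \<open>The element \<open>x\<close> itself lies in its centralizer but not in the
      center.\<close>
    using assms ring_center_subset_centralizer[of x] self_in_centralizer[of x]
    by (intro psubset_card_mono) auto
  show "card (centralizer x) < CARD('a)"
    using assms by (intro psubset_card_mono) (auto simp: not_central_iff centralizer_def)
  show "0 < card (ring_center :: 'a set)"
    using additive_subgroup_zero[OF additive_subgroup_ring_center] by (auto simp: card_gt_0_iff)
qed

section \<open>Vertex degrees\<close>

lemma degree_zero: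
  fixes x :: "'a::{ring, finite}"
  assumes "x \<notin> ring_center"
  shows "graph_degree (r_nc_graph 0) x = CARD('a) - card (centralizer x)"
proof -
  have "{y. (x, y) \<in> parcs (r_nc_graph 0)} = - centralizer x"
    using assms ring_center_subset_centralizer[of x] self_in_centralizer[of x]
    by (auto simp: r_nc_graph_def centralizer_def)
  then show ?thesis
    by (simp add: graph_degree_r_nc_graph Compl_eq_Diff_UNIV card_Diff_subset)
qed

lemma degree_nonzero:
  fixes x :: "'a::{ring, finite}"
  assumes x: "x \<notin> ring_center" and "r \<noteq> 0"
  shows "CARD('a) = graph_degree (r_nc_graph r) x + card (ring_center :: 'a set) + 1
    + (if r \<notin> range (commutator x) then 0
       else if r = - r then card (centralizer x) else 2 * card (centralizer x))"
proof -
  let ?N = "{y. (x, y) \<in> parcs (r_nc_graph r)}"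
  \<comment> \<open>Apart from \<open>x\<close> and the central elements, the elements not adjacent
    to \<open>x\<close> are those of \<open>?F\<close>. As \<open>r\<close> is nonzero,
    \<open>?F\<close> meets neither \<open>{x}\<close> nor the center.\<close>
  let ?F = "{y. commutator x y = r} \<union> {y. commutator x y = - r}"
  have zero: "commutator x y = 0" if "y \<in> insert x ring_center" for y
    using that ring_center_subset_centralizer[of x] by (auto simp: commutator_self centralizer_def)
  have "UNIV = (?N \<union> insert x ring_center) \<union> ?F"
    using x by (auto simp: r_nc_graph_def)
  moreover have "(?N \<union> insert x ring_center) \<inter> ?F = {}"
    using zero \<open>r \<noteq> 0\<close> by (force simp: r_nc_graph_def)
  moreover have "?N \<inter> insert x ring_center = {}"
    by (auto simp: r_nc_graph_def)
  ultimately have "CARD('a) = card ?N + card (insert x (ring_center :: 'a set)) + card ?F"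
    by (metis card_Un_disjoint finite)
  \<comment> \<open>The range of \<open>commutator x\<close> is closed under negation, so the fibres
    over \<open>r\<close> and \<open>- r\<close> are both empty or both cosets of the centralizer.
    Nonempty ones coincide exactly when \<open>r = - r\<close>.\<close>
  moreover have "card ?F = (if r \<notin> range (commutator x) then 0
       else if r = - r then card (centralizer x) else 2 * card (centralizer x))"
  proof (cases "r \<in> range (commutator x)")
    case True
    then have "- r \<in> range (commutator x)"
      by (intro additive_subgroup_uminus additive_subgroup_range_commutator)
    show ?thesis
    proof (cases "r = - r")
      case False
      then have "{y. commutator x y = r} \<inter> {y. commutator x y = - r} = {}"
        by auto
      then show ?thesis
        using True \<open>- r \<in> _\<close> False by (simp add: card_Un_disjoint card_commutator_fibre)
    qed (use True card_commutator_fibre[OF True] in auto)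
  next
    case False
    have "- r \<notin> range (commutator x)"
      using False additive_subgroup_uminus[OF additive_subgroup_range_commutator, of "- r" x] by auto
    with False have "?F = {}"
      by (auto simp: image_iff) metis+
    with False show ?thesis
      by simp
  qed
  ultimately show ?thesis
    using x by (simp add: graph_degree_r_nc_graph)
qed

section \<open>Noncommutative rings of order 4\<close>

lemma card_4_elements:
  fixes x y :: "'a::{ring, finite}"
  assumes "CARD('a) = 4" and xy: "x * y \<noteq> y * x"
  shows "UNIV = {0, x, y, x + y}" "distinct [0, x, y, x + y]" "x + x = 0" "y + y = 0"
proof -
  show distinct: "distinct [0, x, y, x + y]"
  proof -
    have "x \<noteq> 0" "y \<noteq> 0" "x \<noteq> y" "x + y \<noteq> 0"
      using xy by (auto simp: eq_neg_iff_add_eq_0[symmetric])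
    then show ?thesis by auto
  qed
  then have "card {0, x, y, x + y} = CARD('a)"
    using assms(1) distinct_card[OF distinct] by simp
  then show univ: "UNIV = {0, x, y, x + y}"
    by (metis card_subset_eq finite subset_UNIV)
  have "x + x \<in> {0, x, y, x + y}" "y + y \<in> {0, x, y, x + y}"
    using univ by blast+
  \<comment> \<open>Each of \<open>x + x = y\<close> and \<open>y + y = x\<close> would make
    \<open>x\<close> and \<open>y\<close> commute. The other nonzero values of the doubles
    contradict distinctness.\<close>
  moreover have "x + x \<noteq> y"
    using xy by (auto simp: algebra_simps)
  moreover have "y + y \<noteq> x"
    using xy by (auto simp: algebra_simps)
  ultimately show "x + x = 0" "y + y = 0"
    using distinct by auto
qed

text \<open>The commutator is biadditive and alternating, and the ring is
  \<open>{0, x, y, x + y}\<close> for some \<open>y\<close>, so every commutator is 0 or plus or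
  minus \<open>commutator x y\<close>.\<close>

lemma card_4_commutator:
  fixes x :: "'a::{ring, finite}"
  assumes "CARD('a) = 4" "x \<notin> ring_center" "r \<in> commutators"
  shows "r \<in> range (commutator x)"
proof -
  obtain y where y: "commutator x y \<noteq> 0"
    using assms(2) not_central_iff by blast
  obtain u v where r: "r = commutator u v"
    using assms(3) by (auto simp: commutators_def)
  have "u \<in> {0, x, y, x + y}" "v \<in> {0, x, y, x + y}"
    using card_4_elements(1)[OF assms(1), of x y] y by (auto simp: commutator_def)
  then have "r \<in> {commutator x 0, commutator x y, commutator x (- y)}"
    unfolding r by (auto simp: commutator_simps commutator_swap[of y x])
  then show ?thesis
    by auto
qed

lemma exhaust_mod_2: "s = 0 \<or> s = 1" for s :: 2
proof -
  have "card {0, 1 :: 2} = CARD(2)"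
    by simp
  then have "{0, 1 :: 2} = UNIV"
    by (metis card_subset_eq finite subset_UNIV)
  then show ?thesis
    by auto
qed

text \<open>The elements \<open>a\<close> and \<open>b\<close> form a basis over the field with two
  elements, and \<open>f\<close> sends an element to its coordinates.\<close>

lemma iso_E_ring:
  fixes a b :: "'a::{ring, finite}"
  assumes "CARD('a) = 4" "a * a = a" "b * b = b" "a * b = a" "b * a = b" "a \<noteq> b"
  shows "\<exists>f :: 'a \<Rightarrow> 2 E_ring. ring_isomorphism f"
proof -
  have nc: "a * b \<noteq> b * a"
    using assms by simp
  note el = card_4_elements[OF assms(1) nc]
  define f :: "'a \<Rightarrow> 2 E_ring" where
    "f z = E_elem (if z \<in> {a, a + b} then 1 else 0) (if z \<in> {b, a + b} then 1 else 0)" for z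
  have vals: "f 0 = E_elem 0 0" "f a = E_elem 1 0" "f b = E_elem 0 1" "f (a + b) = E_elem 1 1"
    using el(2) by (auto simp: f_def)
  have sums: "b + a = a + b" "a + (a + b) = b" "b + (a + b) = a" "(a + b) + a = b"
    "(a + b) + b = a" "(a + b) + (a + b) = 0"
    using el(3,4) by (metis add.commute add.left_commute add_0_right)+
  have prods: "a * (a + b) = 0" "b * (a + b) = 0" "(a + b) * a = a + b" "(a + b) * b = a + b"
    "(a + b) * (a + b) = 0"
    using assms(2-5) el(3,4) sums by (simp_all only: distrib_left distrib_right add_0_left)
  have elem: "z \<in> {0, a, b, a + b}" for z
    using el(1) by blast
  \<comment> \<open>\<open>sums\<close> and \<open>prods\<close> complete the addition and
    multiplication tables, so all 16 pairs can be checked.\<close>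
  have "f (x + y) = f x + f y" "f (x * y) = f x * f y" for x y
    using elem[of x] elem[of y] assms(2-5)
    by (auto simp: vals sums prods el(3,4))
  moreover have "inj f"
  proof (rule injI)
    fix x y assume "f x = f y"
    then show "x = y"
      using elem[of x] elem[of y] by (auto simp: vals)
  qed
  moreover have "surj f"
  proof -
    have "E_elem s t \<in> range f" for s t
      using exhaust_mod_2[of s] exhaust_mod_2[of t] vals by (metis rangeI)
    then show ?thesis
      by (metis E_ring.exhaust UNIV_eq_I)
  qed
  ultimately show ?thesis
    unfolding ring_isomorphism_def bij_def by blast
qed

text \<open>The mirror image of \<open>iso_E_ring\<close>: F(4) is the opposite ring of
  E(4).\<close>

lemma iso_F_ring:
  fixes a b :: "'a::{ring, finite}"
  assumes "CARD('a) = 4" "a * a = a" "b * b = b" "a * b = b" "b * a = a" "a \<noteq> b"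
  shows "\<exists>f :: 'a \<Rightarrow> 2 F_ring. ring_isomorphism f"
proof -
  have nc: "a * b \<noteq> b * a"
    using assms by simp
  note el = card_4_elements[OF assms(1) nc]
  define f :: "'a \<Rightarrow> 2 F_ring" where
    "f z = F_elem (if z \<in> {a, a + b} then 1 else 0) (if z \<in> {b, a + b} then 1 else 0)" for z
  have vals: "f 0 = F_elem 0 0" "f a = F_elem 1 0" "f b = F_elem 0 1" "f (a + b) = F_elem 1 1"
    using el(2) by (auto simp: f_def)
  have sums: "b + a = a + b" "a + (a + b) = b" "b + (a + b) = a" "(a + b) + a = b"
    "(a + b) + b = a" "(a + b) + (a + b) = 0"
    using el(3,4) by (metis add.commute add.left_commute add_0_right)+
  have prods: "(a + b) * a = 0" "(a + b) * b = 0" "a * (a + b) = a + b" "b * (a + b) = a + b"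
    "(a + b) * (a + b) = 0"
    using assms(2-5) el(3,4) sums by (simp_all only: distrib_left distrib_right add_0_left)
  have elem: "z \<in> {0, a, b, a + b}" for z
    using el(1) by blast
  have "f (x + y) = f x + f y" "f (x * y) = f x * f y" for x y
    using elem[of x] elem[of y] assms(2-5)
    by (auto simp: vals sums prods el(3,4))
  moreover have "inj f"
  proof (rule injI)
    fix x y assume "f x = f y"
    then show "x = y"
      using elem[of x] elem[of y] by (auto simp: vals)
  qed
  moreover have "surj f"
  proof -
    have "F_elem s t \<in> range f" for s t
      using exhaust_mod_2[of s] exhaust_mod_2[of t] vals by (metis rangeI)
    then show ?thesis
      by (metis F_ring.exhaust UNIV_eq_I)
  qed
  ultimately show ?thesis
    unfolding ring_isomorphism_def bij_def by blast
qed

text \<open>The square of \<open>x\<close> commutes with \<open>x\<close>, whereas \<open>y\<close>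
  and \<open>x + y\<close> do not.\<close>

lemma card_4_square:
  fixes x y :: "'a::{ring, finite}"
  assumes "CARD('a) = 4" "x * y \<noteq> y * x"
  shows "x * x = 0 \<or> x * x = x"
proof -
  have "x * x \<in> {0, x, y, x + y}"
    using card_4_elements(1)[OF assms] by blast
  moreover have "x * x \<noteq> y" "x * x \<noteq> x + y"
  proof -
    show "x * x \<noteq> y"
      using assms(2) by (metis mult.assoc)
    have "x * (x * x) = (x * x) * x"
      by (simp add: mult.assoc)
    then show "x * x \<noteq> x + y"
      using assms(2) by (auto simp: distrib_left distrib_right)
  qed
  ultimately show ?thesis
    by auto
qed

lemma iso_if_square_zero:
  fixes x y :: "'a::{ring, finite}"
  assumes card: "CARD('a) = 4" and nc: "x * y \<noteq> y * x" and sq: "x * x = 0"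
  shows "(\<exists>f :: 'a \<Rightarrow> 2 E_ring. ring_isomorphism f) \<or> (\<exists>f :: 'a \<Rightarrow> 2 F_ring. ring_isomorphism f)"
proof -
  note el = card_4_elements[OF card nc]
  have "x * (x * y) = 0" "(y * x) * x = 0"
    using sq by (metis mult.assoc mult_zero_left, metis mult.assoc mult_zero_right)
  moreover have "x * y \<in> {0, x, y, x + y}" "y * x \<in> {0, x, y, x + y}"
    using el(1) by blast+
  \<comment> \<open>If \<open>x * y\<close> were \<open>y\<close> or \<open>x + y\<close>,
    multiplying by \<open>x\<close> on the left would return the same nonzero element instead of 0.
    For \<open>y * x\<close>, multiply on the right.\<close>
  ultimately have "x * y \<in> {0, x}" "y * x \<in> {0, x}"
    using el(2) sq by (auto simp: distrib_left distrib_right)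
  with nc consider "x * y = x" "y * x = 0" | "x * y = 0" "y * x = x"
    by auto
  then show ?thesis
  proof cases
    case 1
    \<comment> \<open>Otherwise \<open>y * y = 0\<close>, and then
      \<open>x = (x * y) * y = x * (y * y) = 0\<close>.\<close>
    have "y * y = y"
      using card_4_square[OF card nc[symmetric]] 1 el(2)
      by (metis distinct_length_2_or_more mult.assoc mult_zero_right)
    then have "\<exists>f :: 'a \<Rightarrow> 2 E_ring. ring_isomorphism f"
      \<comment> \<open>Both \<open>y\<close> and \<open>x + y\<close> are idempotent and satisfy
        the relations of the generators.\<close>
      using 1 sq el(2) by (intro iso_E_ring[OF card, of y "x + y"]) (auto simp: distrib_left distrib_right)
    then show ?thesis ..
  next
    case 2
    have "y * y = y"
      using card_4_square[OF card nc[symmetric]] 2 el(2)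
      by (metis distinct_length_2_or_more mult.assoc mult_zero_left)
    then have "\<exists>f :: 'a \<Rightarrow> 2 F_ring. ring_isomorphism f"
      using 2 sq el(2) by (intro iso_F_ring[OF card, of y "x + y"]) (auto simp: distrib_left distrib_right)
    then show ?thesis ..
  qed
qed

lemma noncommutative_card_4_iso:
  assumes card: "CARD('a::{ring, finite}) = 4" and "\<exists>x y :: 'a::{ring, finite}. x * y \<noteq> y * x"
  shows "(\<exists>f :: 'a::{ring, finite} \<Rightarrow> 2 E_ring. ring_isomorphism f) \<or>
    (\<exists>f :: 'a::{ring, finite} \<Rightarrow> 2 F_ring. ring_isomorphism f)"
proof -
  obtain x y :: 'a where nc: "x * y \<noteq> y * x"
    using assms by blast
  note el = card_4_elements[OF card nc]
  have nc': "(x + y) * y \<noteq> y * (x + y)"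
    using nc by (simp add: distrib_left distrib_right)
  \<comment> \<open>If all three were idempotent, expanding the square of \<open>x + y\<close> would
    give \<open>x * y + y * x = 0\<close>. In characteristic 2 this means that \<open>x\<close> and
    \<open>y\<close> commute.\<close>
  have "x * x = 0 \<or> y * y = 0 \<or> (x + y) * (x + y) = 0"
  proof (rule ccontr)
    assume "\<not> ?thesis"
    then have "x * x = x" "y * y = y" "(x + y) * (x + y) = x + y"
      using card_4_square[OF card nc] card_4_square[OF card nc[symmetric]]
        card_4_square[OF card nc'] by auto
    then have "x * y + y * x = 0"
      by (simp add: distrib_left distrib_right algebra_simps)
    moreover have "x * y + x * y = 0"
      using el(3) by (metis distrib_right mult_zero_left)
    ultimately show False
      using nc by (metis add_left_cancel)
  qed
  then show ?thesis
    using iso_if_square_zero[OF card nc] iso_if_square_zero[OF card nc[symmetric]]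
      iso_if_square_zero[OF card nc'] by blast
qed

section \<open>Rings whose order is twice an odd number\<close>

lemma involution_central:
  fixes z :: "'a::{ring, finite}"
  assumes "CARD('a) = 2 * m" "odd m" "z \<noteq> 0" "z + z = 0"
  shows "z \<in> ring_center"
proof (rule ccontr)
  assume "z \<notin> ring_center"
  then obtain y where y: "commutator z y \<noteq> 0"
    using not_central_iff by blast
  \<comment> \<open>This makes \<open>commutator z y\<close> an element of order 2 in the range of
    \<open>commutator z\<close>.\<close>
  have "commutator z y + commutator z y = 0"
    using assms(4) by (metis commutator_add_left commutator_zero_left)
  then have "even (card (range (commutator z)))"
    using y by (intro even_card_subgroupI additive_subgroup_range_commutator) auto
  moreover have "even (card (centralizer z))"
    using even_card_subgroupI[OF additive_subgroup_centralizer self_in_centralizer] assms(3,4) .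
  ultimately have "4 dvd CARD('a)"
    using mult_dvd_mono[of 2 _ 2] unfolding card_range_commutator[of z] by fastforce
  then show False
    using assms(1,2) by auto
qed

lemma even_card_center:
  assumes "CARD('a::{ring, finite}) = 2 * m" "odd m"
  shows "even (card (ring_center :: 'a::{ring, finite} set))"
proof -
  obtain z :: 'a where "z \<noteq> 0" "z + z = 0"
    using exists_additive_involution[where 'a = 'a] assms(1) by auto
  then show ?thesis
    using involution_central[OF assms] additive_subgroup_ring_center
    by (intro even_card_subgroupI)
qed

section \<open>The order of a ring with a vertex of degree 2\<close>

lemma degree_2_card:
  fixes x r :: "'a::{ring, finite}"
  assumes x: "x \<notin> ring_center" and deg: "graph_degree (r_nc_graph r) x = 2"
    and card: "CARD('a) \<notin> {8, 12}" and r: "r \<in> commutators"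
  shows "r = 0 \<and> CARD('a) = 4"
proof -
  let ?z = "card (ring_center :: 'a set)" and ?c = "card (centralizer x)" and ?n = "CARD('a)"
  note sub = card_subgroups[OF x]
  have six: "?n \<noteq> 6" "?n \<noteq> 18" if "odd ?z"
    using even_card_center[where 'a = 'a, of 3] even_card_center[where 'a = 'a, of 9] that
    by auto
  show ?thesis
  proof (cases "r = 0")
    case True
    then have n: "?n = 2 + ?c"
      using deg degree_zero[OF x] sub(4) by simp
    then have "?c dvd 2"
      using sub(2) by (metis dvd_add_left_iff dvd_refl)
    then have "?c \<le> 2"
      by (rule dvd_imp_le) simp
    then have "?c = 2"
      using sub(3,5) by simp
    with n True show ?thesis
      by simp
  next
    case False
    \<comment> \<open>The summand 3 counts the two neighbours and \<open>x\<close> itself;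
      \<open>j\<close> is the number of distinct nonempty fibres over \<open>r\<close> and
      \<open>- r\<close>.\<close>
    obtain j where j: "?n = ?z + 3 + j * ?c" "j \<in> {0, 1, 2}" "j = 0 \<longleftrightarrow> r \<notin> range (commutator x)"
      using degree_nonzero[OF x False] deg
      by (cases "r \<in> range (commutator x)"; cases "r = - r") (force intro: that)+
    have "?z dvd ?n"
      using sub(1,2) by (rule dvd_trans)
    \<comment> \<open>\<open>?z\<close> divides both \<open>?n\<close> and
      \<open>?c\<close>.\<close>
    then have "?z dvd 3"
      using sub(1) unfolding j(1) by (metis dvd_add_left_iff dvd_add_right_iff dvd_mult dvd_refl)
    moreover from this have "?z \<le> 3"
      by (rule dvd_imp_le) simp
    then have "?z = 1 \<or> ?z = 2 \<or> ?z = 3"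
      using sub(5) by linarith
    ultimately have z: "?z = 1 \<or> ?z = 3"
      by auto
    have "?c dvd ?z + 3"
      using sub(2) unfolding j(1) by (simp add: dvd_add_left_iff)
    moreover from this have "?c \<le> ?z + 3"
      by (rule dvd_imp_le) simp
    ultimately have "(?z = 1 \<and> (?c = 2 \<or> ?c = 4)) \<or> (?z = 3 \<and> ?c = 6)"
    proof -
      have "?c = 2 \<or> ?c = 3 \<or> ?c = 4 \<or> ?c = 5 \<or> ?c = 6"
        using z sub(3) \<open>?c \<le> ?z + 3\<close> by linarith
      then show ?thesis
        using z sub(1,3) \<open>?c dvd ?z + 3\<close> by auto
    qed
    \<comment> \<open>The pairs (\<open>?z\<close>, \<open>?c\<close>) = (1, 2), (1, 4), (3, 6) give
      the orders 4 + 2j, 4 + 4j, 6 + 6j. Since \<open>?c < ?n\<close>, the last two need j > 0.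
      Excluding 6, 8, 12 and 18 leaves only order 4, from the first pair with j = 0.\<close>
    then have "j = 0 \<and> ?z = 1"
      using card six sub(4) j(1,2) by auto
    \<comment> \<open>Now \<open>?n = 4\<close> and \<open>r\<close> is outside the range of
      \<open>commutator x\<close>, which \<open>card_4_commutator\<close> forbids.\<close>
    then show ?thesis
      using card_4_commutator[OF _ x r] j(1,3) by simp
  qed
qed

theorem theorem4p9:
  fixes r :: "'a::{ring, finite}"
  assumes noncommutative: "\<exists>x y :: 'a. x * y \<noteq> y * x"
    and card: "CARD('a) \<notin> {8, 12}"
    and r: "r \<in> commutators"
  shows "(\<exists>v \<in> pverts (r_nc_graph r). graph_degree (r_nc_graph r) v = 2) \<longleftrightarrow>
    r = 0 \<and> ((\<exists>f :: 'a \<Rightarrow> 2 E_ring. ring_isomorphism f) \<or>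
              (\<exists>f :: 'a \<Rightarrow> 2 F_ring. ring_isomorphism f))"
proof
  assume "\<exists>v \<in> pverts (r_nc_graph r). graph_degree (r_nc_graph r) v = 2"
  then obtain x where "x \<notin> ring_center" "graph_degree (r_nc_graph r) x = 2"
    by (auto simp: r_nc_graph_def)
  from degree_2_card[OF this card r] noncommutative_card_4_iso[OF _ noncommutative]
  show "r = 0 \<and> ((\<exists>f :: 'a \<Rightarrow> 2 E_ring. ring_isomorphism f) \<or>
              (\<exists>f :: 'a \<Rightarrow> 2 F_ring. ring_isomorphism f))"
    by blast
next
  assume iso: "r = 0 \<and> ((\<exists>f :: 'a \<Rightarrow> 2 E_ring. ring_isomorphism f) \<or>
              (\<exists>f :: 'a \<Rightarrow> 2 F_ring. ring_isomorphism f))"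
  then have "CARD('a) = CARD(2 E_ring) \<or> CARD('a) = CARD(2 F_ring)"
    unfolding ring_isomorphism_def by (metis bij_betw_same_card)
  then have n: "CARD('a) = 4"
    by (auto simp: card_E_ring card_F_ring)
  obtain x :: 'a where x: "x \<notin> ring_center"
    using noncommutative by (auto simp: ring_center_def)
  note sub = card_subgroups[OF x]
  \<comment> \<open>The order of the centralizer divides 4 and lies strictly between 1 and 4, so it
    is 2 and the degree is 4 - 2.\<close>
  have "card (centralizer x) \<noteq> 3"
    using sub(2) by (auto simp: n)
  then have "card (centralizer x) = 2"
    using sub(3-5) by (simp add: n)
  then have "graph_degree (r_nc_graph r) x = 2"
    using iso degree_zero[OF x] n by simp
  moreover have "x \<in> pverts (r_nc_graph r)"
    using x by (simp add: r_nc_graph_def)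
  ultimately show "\<exists>v \<in> pverts (r_nc_graph r). graph_degree (r_nc_graph r) v = 2"
    by blast
qed

end
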